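(* The map $\Psi\colon\mathrm{Mat}\to\mathrm{WQSym}$ from matroids to word-quasisymmetric functions is strongly valuative; that is, there is an additive map $\widehat\Psi\colon\mathrm{PS}\to\mathrm{WQSym}$ such that $\Psi(M)=\widehat\Psi(\mathbb 1[P_M])$ for every $d\ge0$ and every matroid $M$ on $[d]$.
   Context: $[d]=\{1,\dots,d\}$, $[0]=\emptyset$. For a matroid $M$ on $[d]$, $f\colon[d]\to\mathbb R$ and a basis $B$ put $f(B)=\sum_{i\in B}f(i)$; $f$ is $M$-generic if there is a unique basis $B$ of $M$ maximizing $f(B)$. Let $w_1,w_2,\dots$ be non-commuting variables and $w_f=w_{f(1)}\cdots w_{f(d)}$ for $f\colon[d]\to\mathbb Z_{\ge1}$. Then $\Psi(M)=\sum_{f} w_f$, the sum over all $M$-generic $f\colon[d]\to\mathbb Z_{\ge 1}$. The set composition type of $f$ is the ordered partition of $[d]$ into the level sets of $f$, listed by increasing value. $\mathrm{WQSym}_d$ is the real vector space of formal series $\sum_{f:[d]\to\mathbb Z_{\ge1}}c_fw_f$ with $c_f=c_g$ whenever $f,g$ have the same set composition type; $\mathrm{WQSym}=\bigoplus_{d\ge 0}\mathrm{WQSym}_d$. $\mathrm{Mat}=\bigoplus_{d\ge0}\mathrm{Mat}_d$, where $\mathrm{Mat}_d$ has basis all matroids on $[d]$, and $\Psi$ is extended linearly. $P_M=\mathrm{conv}\{\mathbb 1_B: B\text{ a basis of }M\}\subset\mathbb R^d$ is the matroid base polytope ($\mathbb 1_B$ the 0/1 indicator vector), and $\mathbb 1[P_M]\colon\mathbb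 R^d\to\{0,1\}$ is its indicator function. $\mathrm{PS}_{d}$ is the additive group of functions $\mathbb R^d\to\mathbb Z$ generated by the functions $\mathbb 1[P_M]$, $M$ a matroid on $[d]$, and $\mathrm{PS}=\bigoplus_{d\ge0}\mathrm{PS}_d$. *)

theory Defs
  imports
    "HOL-Analysis.Analysis"
    "HOL-Library.Function_Algebras"
    "HOL-Library.Poly_Mapping"
    "HOL-Computational_Algebra.Group_Closure"
begin

text \<open>
  Pointwise scalar multiplication. Together with the pointwise group structure of
  \<^theory>\<open>HOL-Library.Function_Algebras\<close> it makes the library's convex hull available
  for vectors of type \<^typ>\<open>nat \<Rightarrow> real\<close>.
\<close>

instantiation "fun" :: (type, real_vector) real_vector
begin

definition scaleR_fun :: "real \<Rightarrow> ('a \<Rightarrow> 'b) \<Rightarrow> 'a \<Rightarrow> 'b" where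
  "scaleR_fun c f = (\<lambda>x. c *\<^sub>R f x)"

instance
  by standard (simp_all add: scaleR_fun_def plus_fun_def fun_eq_iff scaleR_add_right scaleR_add_left)

end

text \<open>A direct sum over all degrees: finitely supported families, homogeneous in each degree.\<close>

definition direct_sum :: "(nat \<Rightarrow> 'a::zero set) \<Rightarrow> (nat \<Rightarrow>\<^sub>0 'a) set" where
  "direct_sum A = {p. \<forall>d. Poly_Mapping.lookup p d \<in> A d}"


subsection \<open>Matroids\<close>

text \<open>A matroid on \<open>{1..d}\<close> is given by its set of bases.\<close>

definition matroid :: "nat \<Rightarrow> nat set set \<Rightarrow> bool" where
  "matroid d M \<longleftrightarrow> M \<noteq> {} \<and> M \<subseteq> Pow {1..d} \<and>
     (\<forall>A\<in>M. \<forall>B\<in>M. \<forall>x\<in>A - B. \<exists>y\<in>B - A. insert y (A - {x}) \<in> M)"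

definition M_generic :: "nat set set \<Rightarrow> (nat \<Rightarrow> real) \<Rightarrow> bool" where
  "M_generic M f \<longleftrightarrow> (\<exists>!B. is_arg_max (\<lambda>B. \<Sum>i\<in>B. f i) (\<lambda>B. B \<in> M) B)"

definition Mat_deg :: "nat \<Rightarrow> (nat set set \<Rightarrow>\<^sub>0 real) set" where
  "Mat_deg d = {m. \<forall>M\<in>Poly_Mapping.keys m. matroid d M}"

definition Mat :: "(nat \<Rightarrow>\<^sub>0 nat set set \<Rightarrow>\<^sub>0 real) set" where
  "Mat = direct_sum Mat_deg"


subsection \<open>Word-quasisymmetric functions\<close>

text \<open>
  Words in the non-commuting variables \<open>w\<^sub>1, w\<^sub>2, \<dots>\<close> are lists of their indices;
  a formal series is the function assigning to each word its coefficient.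
\<close>

definition letter_maps :: "nat \<Rightarrow> (nat \<Rightarrow> nat) set" where
  "letter_maps d = {1..d} \<rightarrow>\<^sub>E {1..}"

definition word_of :: "nat \<Rightarrow> (nat \<Rightarrow> nat) \<Rightarrow> nat list" where
  "word_of d f = map f [1..<Suc d]"

definition set_comp_type :: "nat \<Rightarrow> (nat \<Rightarrow> nat) \<Rightarrow> nat set list" where
  "set_comp_type d f =
     map (\<lambda>v. {i \<in> {1..d}. f i = v}) (sorted_list_of_set (f ` {1..d}))"

definition WQSym_deg :: "nat \<Rightarrow> (nat list \<Rightarrow> real) set" where
  "WQSym_deg d = {F.
     (\<forall>u. u \<notin> word_of d ` letter_maps d \<longrightarrow> F u = 0) \<and>
     (\<forall>f\<in>letter_maps d. \<forall>g\<in>letter_maps d.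
        set_comp_type d f = set_comp_type d g \<longrightarrow> F (word_of d f) = F (word_of d g))}"

definition WQSym :: "(nat \<Rightarrow>\<^sub>0 nat list \<Rightarrow> real) set" where
  "WQSym = direct_sum WQSym_deg"

text \<open>
  The coefficient of a word in \<open>\<Sum>f. w\<^sub>f\<close> is the number of summands equal to it
  (here at most one, since \<open>f\<close> is determined by \<open>w\<^sub>f\<close>).
\<close>

definition Psi_matroid :: "nat \<Rightarrow> nat set set \<Rightarrow> (nat list \<Rightarrow> real)" where
  "Psi_matroid d M =
     (\<lambda>u. real (card {f \<in> letter_maps d. M_generic M (\<lambda>i. real (f i)) \<and> word_of d f = u}))"

definition Psi_deg :: "nat \<Rightarrow> (nat set set \<Rightarrow>\<^sub>0 real) \<Rightarrow> (nat list \<Rightarrow> real)" where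
  "Psi_deg d m = (\<Sum>M\<in>Poly_Mapping.keys m. Poly_Mapping.lookup m M *\<^sub>R Psi_matroid d M)"

definition Psi :: "(nat \<Rightarrow>\<^sub>0 nat set set \<Rightarrow>\<^sub>0 real) \<Rightarrow> (nat \<Rightarrow>\<^sub>0 nat list \<Rightarrow> real)" where
  "Psi m =
     (\<Sum>d\<in>Poly_Mapping.keys m. Poly_Mapping.single d (Psi_deg d (Poly_Mapping.lookup m d)))"


subsection \<open>Indicator functions of matroid base polytopes\<close>

text \<open>
  \<open>\<real>\<^sup>d\<close> is the space of all \<open>x :: nat \<Rightarrow> real\<close> vanishing outside \<open>{1..d}\<close>, and functions
  \<open>\<real>\<^sup>d \<rightarrow> \<int>\<close> are extended by zero to all of \<^typ>\<open>nat \<Rightarrow> real\<close>. For a matroid on \<open>{1..d}\<close>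
  the polytope lies in \<open>\<real>\<^sup>d\<close>, so its indicator function is of this form.
\<close>

definition base_polytope :: "nat set set \<Rightarrow> (nat \<Rightarrow> real) set" where
  "base_polytope M = convex hull ((\<lambda>B. indicator B) ` M)"

definition PS_deg :: "nat \<Rightarrow> ((nat \<Rightarrow> real) \<Rightarrow> int) set" where
  "PS_deg d = group_closure {indicator (base_polytope M) | M. matroid d M}"

definition PS :: "(nat \<Rightarrow>\<^sub>0 (nat \<Rightarrow> real) \<Rightarrow> int) set" where
  "PS = direct_sum PS_deg"

text \<open>
  The copies of a matroid \<open>M\<close> on \<open>{1..d}\<close> in \<^const>\<open>Mat\<close> and of \<open>\<one>[P\<^sub>M]\<close> in \<^const>\<open>PS\<close>
  sit in degree \<open>d\<close>. A map out of \<^const>\<open>Mat\<close> with values in the group \<open>V\<close> is strongly valuative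
  if it factors additively through \<^const>\<open>PS\<close>.
\<close>

definition matroid_elem :: "nat \<Rightarrow> nat set set \<Rightarrow> (nat \<Rightarrow>\<^sub>0 nat set set \<Rightarrow>\<^sub>0 real)" where
  "matroid_elem d M = Poly_Mapping.single d (Poly_Mapping.single M 1)"

definition indicator_elem :: "nat \<Rightarrow> nat set set \<Rightarrow> (nat \<Rightarrow>\<^sub>0 (nat \<Rightarrow> real) \<Rightarrow> int)" where
  "indicator_elem d M = Poly_Mapping.single d (indicator (base_polytope M))"

definition strongly_valuative ::
  "'v::ab_group_add set \<Rightarrow> ((nat \<Rightarrow>\<^sub>0 nat set set \<Rightarrow>\<^sub>0 real) \<Rightarrow> 'v) \<Rightarrow> bool" where
  "strongly_valuative V \<phi> \<longleftrightarrow>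
     (\<exists>\<psi>. \<psi> \<in> PS \<rightarrow> V \<and>
        (\<forall>p\<in>PS. \<forall>q\<in>PS. \<psi> (p + q) = \<psi> p + \<psi> q) \<and>
        (\<forall>d M. matroid d M \<longrightarrow> \<phi> (matroid_elem d M) = \<psi> (indicator_elem d M)))"

end

theory Submission
  imports Defs
begin

text \<open>
  The coefficient of \<open>w\<^sub>f\<close> in \<open>\<Psi>(M)\<close> is a signed count of sets \<open>B \<subseteq> {1..d}\<close> for which \<open>P\<^sub>M\<close>
  meets a halfspace \<open>{x. h\<^sub>B x \<ge> t}\<close>, where \<open>h\<^sub>B\<close> is a perturbation of \<open>f\<close> breaking ties against \<open>B\<close>.
  Whether a compact convex set is nonempty is its Euler characteristic, so an integer relation
  between the functions \<open>\<one>[P\<^sub>M]\<close> also holds between these counts.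
\<close>

subsection \<open>Euler characteristic of compact convex sets\<close>

text \<open>The Euler characteristic of the line: passing a point \<open>\<beta>\<close> to the
  right, the indicator of a nonempty closed interval drops exactly if the interval ends at
  \<open>\<beta>\<close>. Every interval has one right end, so summing these drops over all
  \<open>\<beta>\<close> recovers \<open>sum n I\<close>.\<close>

lemma sum_Icc_indicators_eq_zero:
  fixes a b :: "'i \<Rightarrow> real" and n :: "'i \<Rightarrow> int"
  assumes fin: "finite I" and le: "\<And>i. i \<in> I \<Longrightarrow> a i \<le> b i"
    and zero: "\<And>t. (\<Sum>i\<in>I. n i * of_bool (t \<in> {a i..b i})) = 0"
  shows "sum n I = 0"
proof -
  \<comment> \<open>Compare the relation at \<open>\<beta>\<close> and just to the right of it: only the intervals ending at \<open>\<beta>\<close> change.\<close>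
  have endpoint: "sum n {i \<in> I. b i = \<beta>} = 0" for \<beta>
  proof -
    \<comment> \<open>\<open>E\<close> collects the endpoints beyond \<open>\<beta>\<close>; with
      \<open>s\<close> below all of them, no interval begins or ends strictly after
      \<open>\<beta>\<close> and up to \<open>s\<close>.\<close>
    define E where "E = {x \<in> a ` I \<union> b ` I. x > \<beta>}"
    have finE: "finite E" unfolding E_def using fin by simp
    obtain s where s: "s > \<beta>" "\<And>x. x \<in> E \<Longrightarrow> s < x"
    proof (cases "E = {}")
      case True
      then show ?thesis using that[of "\<beta> + 1"] by simp
    next
      case False
      have "Min E > \<beta>" using Min_in[OF finE False] by (simp add: E_def)
      then obtain s where "\<beta> < s" "s < Min E" using dense by blast
      then show ?thesis using that[of s] finE False by (auto simp: Min_gr_iff)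
    qed
    have jump: "of_bool (\<beta> \<in> {a i..b i}) - of_bool (s \<in> {a i..b i}) = (of_bool (b i = \<beta>) :: int)"
      if "i \<in> I" for i
    proof -
      have "a i > \<beta> \<Longrightarrow> s < a i" "b i > \<beta> \<Longrightarrow> s < b i"
        using that by (auto intro!: s(2) simp: E_def)
      then show ?thesis using le[OF that] s(1) by (cases "a i > \<beta>"; cases "b i > \<beta>") auto
    qed
    have "sum n {i \<in> I. b i = \<beta>} = (\<Sum>i\<in>I. n i * of_bool (b i = \<beta>))"
      using fin by (simp add: sum.inter_filter of_bool_def if_distrib cong: if_cong)
    also have "\<dots> = (\<Sum>i\<in>I. n i * of_bool (\<beta> \<in> {a i..b i}) - n i * of_bool (s \<in> {a i..b i}))"
      by (intro sum.cong refl) (simp only: jump[symmetric] right_diff_distrib)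
    also have "\<dots> = 0" unfolding sum_subtractf zero by simp
    finally show ?thesis .
  qed
  show ?thesis
    using sum.image_gen[OF fin, of n b] by (simp add: endpoint)
qed

text \<open>Nonempty compact convex subsets of the line are closed intervals. Empty ones contribute
  to neither sum and are dropped, which keeps the endpoints in order.\<close>

lemma sum_intervals_eq_zero:
  fixes J :: "'i \<Rightarrow> real set" and n :: "'i \<Rightarrow> int"
  assumes fin: "finite I" and J: "\<And>i. i \<in> I \<Longrightarrow> compact (J i) \<and> convex (J i)"
    and zero: "\<And>t. (\<Sum>i\<in>I. n i * of_bool (t \<in> J i)) = 0"
  shows "(\<Sum>i\<in>I. n i * of_bool (J i \<noteq> {})) = 0"
proof -
  define I' where "I' = {i \<in> I. J i \<noteq> {}}"
  have fin': "finite I'" unfolding I'_def using fin by simp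
  have "\<exists>l u. J i = {l..u} \<and> l \<le> u" if "i \<in> I'" for i
  proof -
    have "connected (J i) \<and> compact (J i)" "J i \<noteq> {}"
      using that J convex_connected by (auto simp: I'_def)
    then show ?thesis by (metis connected_compact_interval_1 atLeastatMost_empty_iff)
  qed
  then obtain a b where ab: "\<And>i. i \<in> I' \<Longrightarrow> J i = {a i..b i} \<and> a i \<le> b i" by metis
  have "(\<Sum>i\<in>I'. n i * of_bool (t \<in> {a i..b i})) = 0" for t
  proof -
    have "(\<Sum>i\<in>I'. n i * of_bool (t \<in> {a i..b i})) = (\<Sum>i\<in>I'. n i * of_bool (t \<in> J i))"
      using ab by (intro sum.cong) auto
    also have "\<dots> = (\<Sum>i\<in>I. n i * of_bool (t \<in> J i))"
      by (intro sum.mono_neutral_left fin) (auto simp: I'_def)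
    finally show ?thesis using zero by simp
  qed
  then have "sum n I' = 0" using sum_Icc_indicators_eq_zero[OF fin'] ab by blast
  moreover have "(\<Sum>i\<in>I. n i * of_bool (J i \<noteq> {})) = sum n I'"
    unfolding I'_def using fin by (simp add: sum.inter_filter of_bool_def if_distrib cong: if_cong)
  ultimately show ?thesis by simp
qed

text \<open>
  Slicing along one coordinate: each slice is again compact and convex, and the parameters
  of the nonempty slices form a compact interval.
\<close>

proposition sum_compact_convex_eq_zero:
  fixes K :: "'i \<Rightarrow> ('a \<Rightarrow> real) set" and n :: "'i \<Rightarrow> int"
  assumes "finite S" and fin: "finite I"
    and "\<And>i. i \<in> I \<Longrightarrow> compact (K i) \<and> convex (K i)"
    and "\<And>i. i \<in> I \<Longrightarrow> K i \<subseteq> {x. \<forall>j. j \<notin> S \<longrightarrow> x j = c j}"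
    and "\<And>x. (\<Sum>i\<in>I. n i * of_bool (x \<in> K i)) = 0"
  shows "(\<Sum>i\<in>I. n i * of_bool (K i \<noteq> {})) = 0"
  using assms(1,3-)
proof (induction S arbitrary: K c)
  case empty
  \<comment> \<open>Without free coordinates \<open>K i\<close> has at most the single point
    \<open>c\<close>.\<close>
  have "K i \<noteq> {} \<longleftrightarrow> c \<in> K i" if "i \<in> I" for i
    using empty.prems(2)[OF that] by (auto simp: fun_eq_iff[symmetric])
  then have "(\<Sum>i\<in>I. n i * of_bool (K i \<noteq> {})) = (\<Sum>i\<in>I. n i * of_bool (c \<in> K i))"
    by (intro sum.cong) auto
  then show ?case using empty.prems(3) by simp
next
  case (insert k S)
  have coord: "continuous_on A (\<lambda>x :: 'a \<Rightarrow> real. x k)" for A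
    by (rule continuous_on_subset[OF continuous_on_product_coordinates]) simp
  have lin: "linear (\<lambda>x :: 'a \<Rightarrow> real. x k)"
    by (rule linearI) (simp_all add: scaleR_fun_def)
  have slice: "(\<Sum>i\<in>I. n i * of_bool (t \<in> (\<lambda>x. x k) ` K i)) = 0" for t
  proof -
    have hyp: "{x :: 'a \<Rightarrow> real. x k = t} = (\<lambda>x. x k) -` {t}" by auto
    have "closed {x :: 'a \<Rightarrow> real. x k = t}"
      unfolding hyp by (rule closed_vimage) (simp_all add: coord)
    moreover have "convex {x :: 'a \<Rightarrow> real. x k = t}"
      unfolding hyp by (rule convex_linear_vimage[OF lin]) simp
    ultimately have "compact (K i \<inter> {x. x k = t}) \<and> convex (K i \<inter> {x. x k = t})" if "i \<in> I" for i
      using insert.prems(1)[OF that] by (auto intro: compact_Int_closed convex_Int)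
    \<comment> \<open>Coordinate \<open>k\<close> moves from the free to the fixed ones, with value
      \<open>t\<close>; hence the induction must leave \<open>c\<close> arbitrary.\<close>
    moreover have "K i \<inter> {x. x k = t} \<subseteq> {x. \<forall>j. j \<notin> S \<longrightarrow> x j = (c(k := t)) j}" if "i \<in> I" for i
      using insert.prems(2)[OF that] by auto
    moreover have "(\<Sum>i\<in>I. n i * of_bool (x \<in> K i \<inter> {x. x k = t})) = 0" for x
      using insert.prems(3)[of x] by (cases "x k = t") auto
    ultimately have "(\<Sum>i\<in>I. n i * of_bool (K i \<inter> {x. x k = t} \<noteq> {})) = 0"
      by (rule insert.IH)
    moreover have "K i \<inter> {x. x k = t} \<noteq> {} \<longleftrightarrow> t \<in> (\<lambda>x. x k) ` K i" for i by auto
    ultimately show ?thesis by simp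
  qed
  \<comment> \<open>By \<open>slice\<close>, the relation descends to the projections to coordinate
    \<open>k\<close>, and a projection is empty only if \<open>K i\<close> is.\<close>
  have "(\<Sum>i\<in>I. n i * of_bool ((\<lambda>x. x k) ` K i \<noteq> {})) = 0"
    using insert.prems(1)
    by (intro sum_intervals_eq_zero fin slice)
      (auto intro: compact_continuous_image coord convex_linear_image lin)
  then show ?case by simp
qed

text \<open>Adding a point \<open>v\<close> turns the hull into a cone with apex \<open>v\<close>:
  the image of the compact set of pairs (u, x), with u in [0,1] and x in the old hull, under a map
  that is continuous coordinate by coordinate, hence in the product topology.\<close>

lemma compact_convex_hull_finite_fun:
  fixes V :: "('a \<Rightarrow> real) set"
  assumes "finite V"
  shows "compact (convex hull V)"
  using assms
proof induction
  case (insert v V)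
  show ?case
  proof (cases "V = {}")
    case False
    let ?g = "\<lambda>(u, x). (1 - u) *\<^sub>R v + u *\<^sub>R x :: 'a \<Rightarrow> real"
    have "continuous_on ({0..1} \<times> (convex hull V)) ?g"
      unfolding case_prod_unfold
    proof (rule continuous_on_coordinatewise_then_product)
      fix j
      have "continuous_on A (\<lambda>p :: real \<times> ('a \<Rightarrow> real). snd p j)" for A
        using continuous_on_compose2[OF continuous_on_product_coordinates continuous_on_snd[OF continuous_on_id]]
        by auto
      then show "continuous_on ({0..1} \<times> (convex hull V))
        (\<lambda>p. ((1 - fst p) *\<^sub>R v + fst p *\<^sub>R snd p) j)"
        unfolding plus_fun_def scaleR_fun_def by (intro continuous_intros)
    qed
    then have "compact (?g ` ({0..1} \<times> (convex hull V)))"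
      using insert.IH by (intro compact_continuous_image compact_Times) auto
    moreover have "?g ` ({0..1} \<times> (convex hull V)) = convex hull (insert v V)"
      using False by (auto simp: convex_hull_insert_alt image_def Bex_def)
    ultimately show ?thesis by simp
  qed simp
qed simp

subsection \<open>Maximizing linear functionals over base polytopes\<close>

text \<open>A linear functional is maximal at a vertex: an open halfspace is convex, so if it
  contains all vertices it contains their hull.\<close>

lemma base_polytope_halfspace_nonempty_iff:
  fixes c :: "nat \<Rightarrow> real"
  assumes M: "M \<subseteq> Pow {1..d}"
  shows "base_polytope M \<inter> {x. (\<Sum>i\<in>{1..d}. c i * x i) \<ge> t} \<noteq> {} \<longleftrightarrow> (\<exists>B\<in>M. sum c B \<ge> t)"
proof -
  define h where "h x = (\<Sum>i\<in>{1..d}. c i * x i)" for x :: "nat \<Rightarrow> real"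
  have lin: "linear h"
    unfolding h_def by (rule linearI)
      (simp_all add: scaleR_fun_def algebra_simps sum.distrib sum_distrib_left)
  have h: "h (indicator B) = sum c B" if "B \<in> M" for B
  proof -
    have "{1..d} \<inter> B = B" using M that by auto
    then show ?thesis
      unfolding h_def using sum.inter_restrict[of "{1..d}" c B]
      by (simp add: indicator_def if_distrib cong: if_cong)
  qed
  show ?thesis unfolding h_def[symmetric]
  proof
    assume ne: "base_polytope M \<inter> {x. h x \<ge> t} \<noteq> {}"
    show "\<exists>B\<in>M. sum c B \<ge> t"
    proof (rule ccontr)
      assume "\<not> (\<exists>B\<in>M. sum c B \<ge> t)"
      then have "(\<lambda>B. indicator B) ` M \<subseteq> h -` {..<t}" by (auto simp: h not_le)
      moreover have "convex (h -` {..<t})" by (rule convex_linear_vimage[OF lin]) simp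
      ultimately have "base_polytope M \<subseteq> h -` {..<t}"
        unfolding base_polytope_def by (rule hull_minimal)
      then show False using ne by force
    qed
  next
    assume "\<exists>B\<in>M. sum c B \<ge> t"
    then obtain B where B: "B \<in> M" "sum c B \<ge> t" by blast
    then have "indicator B \<in> base_polytope M" unfolding base_polytope_def by (simp add: hull_inc)
    then show "base_polytope M \<inter> {x. h x \<ge> t} \<noteq> {}" using B h by auto
  qed
qed

text \<open>Multiplying the relation by the indicator of a closed halfspace leaves a relation
  between compact convex sets, to which the Euler characteristic applies.\<close>

lemma sum_ex_basis_ge_eq_zero:
  fixes n :: "nat set set \<Rightarrow> int" and c :: "nat \<Rightarrow> real"
  assumes fin: "finite \<A>" and sub: "\<And>M. M \<in> \<A> \<Longrightarrow> M \<subseteq> Pow {1..d}"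
    and zero: "\<And>x. (\<Sum>M\<in>\<A>. n M * indicator (base_polytope M) x) = 0"
  shows "(\<Sum>M\<in>\<A>. n M * of_bool (\<exists>B\<in>M. sum c B \<ge> t)) = 0"
proof -
  define H where "H = {x :: nat \<Rightarrow> real. (\<Sum>i\<in>{1..d}. c i * x i) \<ge> t}"
  have lin: "linear (\<lambda>x :: nat \<Rightarrow> real. \<Sum>i\<in>{1..d}. c i * x i)"
    by (rule linearI) (simp_all add: scaleR_fun_def algebra_simps sum.distrib sum_distrib_left)
  have H: "H = (\<lambda>x. \<Sum>i\<in>{1..d}. c i * x i) -` {t..}" unfolding H_def by auto
  have "closed H"
    unfolding H by (intro closed_vimage closed_atLeast continuous_intros continuous_on_product_coordinates)
  moreover have "convex H"
    unfolding H by (intro convex_linear_vimage[OF lin] convex_real_interval)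
  moreover have "compact (base_polytope M)" if "M \<in> \<A>" for M
    unfolding base_polytope_def
    using finite_subset[OF sub[OF that]] by (intro compact_convex_hull_finite_fun) simp
  moreover have "convex (base_polytope M)" for M
    unfolding base_polytope_def by (rule convex_convex_hull)
  ultimately have cc: "compact (base_polytope M \<inter> H) \<and> convex (base_polytope M \<inter> H)"
    if "M \<in> \<A>" for M
    using that by (auto intro: compact_Int_closed convex_Int)
  \<comment> \<open>All coordinates outside \<open>{1..d}\<close> are fixed at 0, leaving finitely
    many free ones.\<close>
  have supp: "base_polytope M \<inter> H \<subseteq> {x. \<forall>j. j \<notin> {1..d} \<longrightarrow> x j = 0}" if "M \<in> \<A>" for M
  proof -
    have "convex {x :: nat \<Rightarrow> real. \<forall>j. j \<notin> {1..d} \<longrightarrow> x j = 0}"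
      by (auto simp: convex_def scaleR_fun_def)
    then have "base_polytope M \<subseteq> {x. \<forall>j. j \<notin> {1..d} \<longrightarrow> x j = 0}"
      unfolding base_polytope_def
      using sub[OF that] by (intro hull_minimal) (auto simp: indicator_def subset_iff)
    then show ?thesis by blast
  qed
  have "(\<Sum>M\<in>\<A>. n M * of_bool (x \<in> base_polytope M \<inter> H)) = 0" for x
    using zero[of x] by (cases "x \<in> H") (auto simp: indicator_def of_bool_def)
  then have "(\<Sum>M\<in>\<A>. n M * of_bool (base_polytope M \<inter> H \<noteq> {})) = 0"
    by (intro sum_compact_convex_eq_zero[OF finite_atLeastAtMost fin cc supp])
  then show ?thesis
    using base_polytope_halfspace_nonempty_iff[OF sub]
    unfolding H_def by (simp cong: sum.cong)
qed

subsection \<open>Genericity\<close>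

lemma M_generic_iff:
  "M_generic M f \<longleftrightarrow> (\<exists>B\<in>M. \<forall>A\<in>M. A \<noteq> B \<longrightarrow> sum f A < sum f B)"
proof
  assume "M_generic M f"
  then obtain B where B: "is_arg_max (sum f) (\<lambda>B. B \<in> M) B"
    and uniq: "\<And>A. is_arg_max (sum f) (\<lambda>B. B \<in> M) A \<Longrightarrow> A = B"
    unfolding M_generic_def by blast
  have "sum f A < sum f B" if "A \<in> M" "A \<noteq> B" for A
  proof (rule ccontr)
    assume "\<not> sum f A < sum f B"
    then have "is_arg_max (sum f) (\<lambda>B. B \<in> M) A" using B that by (auto simp: is_arg_max_def)
    then show False using uniq that by blast
  qed
  then show "\<exists>B\<in>M. \<forall>A\<in>M. A \<noteq> B \<longrightarrow> sum f A < sum f B"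
    using B by (auto simp: is_arg_max_def)
next
  assume "\<exists>B\<in>M. \<forall>A\<in>M. A \<noteq> B \<longrightarrow> sum f A < sum f B"
  then show "M_generic M f"
    unfolding M_generic_def is_arg_max_def by (metis less_asym)
qed

text \<open>
  The perturbed weight \<open>(d + 1) f - \<one>\<^sub>B\<close> breaks ties against \<open>B\<close>, so \<open>B\<close> maximizes it if and only
  if \<open>B\<close> is the unique maximizer of \<open>f\<close>. Since \<open>f \<ge> 1\<close>, among all subsets of \<open>{1..d}\<close>, only \<open>B\<close> attains its
  perturbed weight; hence it suffices to know the value of the maximum.
\<close>

definition perturbed :: "nat \<Rightarrow> (nat \<Rightarrow> nat) \<Rightarrow> nat set \<Rightarrow> nat \<Rightarrow> int" where
  "perturbed d f B i = int (Suc d * f i) - of_bool (i \<in> B)"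

lemma sum_perturbed:
  "finite A \<Longrightarrow> sum (perturbed d f B) A = int (Suc d) * int (sum f A) - int (card (A \<inter> B))"
  unfolding perturbed_def by (simp add: sum_subtractf sum_distrib_left distrib_right sum.distrib Int_def
      flip: sum.inter_filter)

lemma unique_max_iff_perturbed:
  assumes M: "M \<subseteq> Pow {1..d}" and B: "B \<subseteq> {1..d}" and pos: "\<And>i. i \<in> {1..d} \<Longrightarrow> f i \<ge> 1"
  defines "w \<equiv> sum (perturbed d f B)"
  shows "B \<in> M \<and> (\<forall>A\<in>M. A \<noteq> B \<longrightarrow> sum f A < sum f B) \<longleftrightarrow>
    (\<exists>A\<in>M. w A \<ge> w B) \<and> \<not> (\<exists>A\<in>M. w A \<ge> w B + 1)"
proof -
  have finB: "finite B" and cardB: "card B \<le> d"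
    using B finite_subset card_mono[OF _ B] by auto
  have w: "w A = (int d + 1) * int (sum f A) - int (card (A \<inter> B))" if "A \<subseteq> {1..d}" for A
    unfolding w_def using sum_perturbed[OF finite_subset[OF that]] by (simp add: algebra_simps)
  have wB: "w B = (int d + 1) * int (sum f B) - int (card B)" using w[OF B] by simp
  have le: "card (A \<inter> B) \<le> card B" for A using finB by (simp add: card_mono)
  have inj: "A = B" if A: "A \<in> M" and eq: "w A = w B" for A
  proof -
    have sub: "A \<subseteq> {1..d}" using A M by auto
    have prod: "(int d + 1) * (int (sum f A) - int (sum f B)) = int (card (A \<inter> B)) - int (card B)"
      using eq w[OF sub] wB by (simp add: algebra_simps)
    \<comment> \<open>The right side of \<open>prod\<close> has absolute value at most
      \<open>d\<close>, but it is a multiple of \<open>d + 1\<close>.\<close>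
    have "int (sum f A) - int (sum f B) = 0"
    proof (rule ccontr)
      assume "int (sum f A) - int (sum f B) \<noteq> 0"
      then have "\<bar>(int d + 1) * (int (sum f A) - int (sum f B))\<bar> \<ge> (int d + 1) * 1"
        unfolding abs_mult by (intro mult_mono) auto
      then have "int d + 1 \<le> \<bar>int (card (A \<inter> B)) - int (card B)\<bar>"
        unfolding prod by simp
      moreover have "int (card (A \<inter> B)) \<le> int (card B)" "int (card B) \<le> int d"
        using le[of A] cardB by simp_all
      ultimately show False by linarith
    qed
    then have "card (A \<inter> B) = card B" and f: "sum f A = sum f B"
      using prod by (simp_all del: of_nat_sum)
    then have "B \<subseteq> A" using finB by (metis card_subset_eq inf_le2 le_iff_inf inf_commute)
    moreover have "A \<subseteq> B"
    proof (rule ccontr)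
      assume "\<not> A \<subseteq> B"
      then obtain i where i: "i \<in> A" "i \<notin> B" by auto
      have fA: "finite A" using sub finite_subset by auto
      \<comment> \<open>Positivity of \<open>f\<close> enters here: the extra element
        \<open>i\<close> makes \<open>A\<close> strictly heavier than its subset
        \<open>B\<close>.\<close>
      have "sum f B < sum f A"
        by (rule sum_strict_mono2[OF fA \<open>B \<subseteq> A\<close>, of i]) (use i pos sub in force)+
      then show False using f by simp
    qed
    ultimately show ?thesis by auto
  qed
  show ?thesis
  proof
    assume L: "B \<in> M \<and> (\<forall>A\<in>M. A \<noteq> B \<longrightarrow> sum f A < sum f B)"
    have "w A < w B + 1" if A: "A \<in> M" for A
    proof (cases "A = B")
      case False
      \<comment> \<open>A gap of at least 1 in \<open>f\<close> is stretched to
        \<open>d + 1\<close>, more than the penalty of at most \<open>d\<close> on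
        \<open>B\<close>.\<close>
      then have "sum f A + 1 \<le> sum f B" using L A by force
      then have "int (sum f A) + 1 \<le> int (sum f B)" by linarith
      then have "(int d + 1) * (int (sum f A) + 1) \<le> (int d + 1) * int (sum f B)"
        by (intro mult_left_mono) auto
      then have "(int d + 1) * int (sum f A) + (int d + 1) \<le> (int d + 1) * int (sum f B)"
        by (simp add: distrib_left)
      moreover have "A \<subseteq> {1..d}" using A M by auto
      ultimately show ?thesis using w[of A] wB cardB by linarith
    qed simp
    then show "(\<exists>A\<in>M. w A \<ge> w B) \<and> \<not> (\<exists>A\<in>M. w A \<ge> w B + 1)" using L by (auto simp: not_le)
  next
    assume R: "(\<exists>A\<in>M. w A \<ge> w B) \<and> \<not> (\<exists>A\<in>M. w A \<ge> w B + 1)"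
    then obtain A where A: "A \<in> M" "w A \<ge> w B" "\<not> w A \<ge> w B + 1" by blast
    then have "A = B" by (intro inj) auto
    then have "B \<in> M" using A by simp
    moreover have "sum f C < sum f B" if C: "C \<in> M" "C \<noteq> B" for C
    proof -
      \<comment> \<open>No set of \<open>M\<close> exceeds \<open>w B\<close>, and
        \<open>inj\<close> rules out a tie. Since \<open>B\<close> is penalized at least as much as
        \<open>C\<close>, the strict inequality passes to \<open>f\<close>.\<close>
      have "w C < w B" using R C inj by force
      moreover have "C \<subseteq> {1..d}" using C M by auto
      ultimately have "(int d + 1) * int (sum f C) < (int d + 1) * int (sum f B)"
        using w[of C] wB le[of C] by linarith
      then show ?thesis by (simp add: mult_less_cancel_left_pos del: of_nat_sum)
    qed
    ultimately show "B \<in> M \<and> (\<forall>A\<in>M. A \<noteq> B \<longrightarrow> sum f A < sum f B)" by blast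
  qed
qed

text \<open>Weights are integers, so "the maximum equals t" is the threshold event for t minus that
  for t + 1. At most one \<open>B\<close> is the unique maximizer, so the sum over \<open>B\<close>
  is 0 or 1.\<close>

lemma of_bool_M_generic:
  assumes M: "M \<subseteq> Pow {1..d}" and pos: "\<And>i. i \<in> {1..d} \<Longrightarrow> f i \<ge> (1::nat)"
  shows "(of_bool (M_generic M (\<lambda>i. real (f i))) :: int) =
    (\<Sum>B\<in>Pow {1..d}.
       of_bool (\<exists>A\<in>M. sum (perturbed d f B) A \<ge> sum (perturbed d f B) B) -
       of_bool (\<exists>A\<in>M. sum (perturbed d f B) A \<ge> sum (perturbed d f B) B + 1))"
proof -
  define U where "U B \<longleftrightarrow> B \<in> M \<and> (\<forall>A\<in>M. A \<noteq> B \<longrightarrow> sum f A < sum f B)" for B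
  have gen: "M_generic M (\<lambda>i. real (f i)) \<longleftrightarrow> (\<exists>B. U B)"
    unfolding M_generic_iff U_def by (auto simp flip: of_nat_sum)
  have "(\<Sum>B\<in>Pow {1..d}.
       of_bool (\<exists>A\<in>M. sum (perturbed d f B) A \<ge> sum (perturbed d f B) B) -
       of_bool (\<exists>A\<in>M. sum (perturbed d f B) A \<ge> sum (perturbed d f B) B + 1)) =
     (\<Sum>B\<in>Pow {1..d}. of_bool (U B) :: int)"
  proof (intro sum.cong refl)
    fix B assume "B \<in> Pow {1..d}"
    then have "U B \<longleftrightarrow> (\<exists>A\<in>M. sum (perturbed d f B) A \<ge> sum (perturbed d f B) B) \<and>
        \<not> (\<exists>A\<in>M. sum (perturbed d f B) A \<ge> sum (perturbed d f B) B + 1)"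
      unfolding U_def by (intro unique_max_iff_perturbed M pos) auto
    moreover have "(\<exists>A\<in>M. sum (perturbed d f B) A \<ge> sum (perturbed d f B) B + 1) \<Longrightarrow>
        (\<exists>A\<in>M. sum (perturbed d f B) A \<ge> sum (perturbed d f B) B)"
      by (erule bexE, rule bexI) auto
    ultimately show "of_bool (\<exists>A\<in>M. sum (perturbed d f B) A \<ge> sum (perturbed d f B) B) -
        of_bool (\<exists>A\<in>M. sum (perturbed d f B) A \<ge> sum (perturbed d f B) B + 1) =
        (of_bool (U B) :: int)"
      by (simp add: of_bool_def)
  qed
  also have "\<dots> = of_bool (\<exists>B. U B)"
  proof (cases "\<exists>B. U B")
    case True
    then obtain B where B: "U B" by blast
    then have "U A \<longleftrightarrow> A = B" for A unfolding U_def by (metis less_asym)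
    moreover have "B \<in> Pow {1..d}" using B M by (auto simp: U_def)
    ultimately show ?thesis using True by (simp add: of_bool_def)
  qed simp
  finally show ?thesis using gen by simp
qed

text \<open>Genericity is now a signed sum of threshold events, each of which respects the relation
  between indicator functions.\<close>

lemma sum_generic_eq_zero:
  fixes n :: "nat set set \<Rightarrow> int"
  assumes fin: "finite \<A>" and sub: "\<And>M. M \<in> \<A> \<Longrightarrow> M \<subseteq> Pow {1..d}"
    and zero: "\<And>x. (\<Sum>M\<in>\<A>. n M * indicator (base_polytope M) x) = 0"
    and pos: "\<And>i. i \<in> {1..d} \<Longrightarrow> f i \<ge> (1::nat)"
  shows "(\<Sum>M\<in>\<A>. n M * of_bool (M_generic M (\<lambda>i. real (f i)))) = 0"
proof -
  have ge: "(\<Sum>M\<in>\<A>. n M * of_bool (\<exists>A\<in>M. sum (perturbed d f B) A \<ge> t)) = 0" for B t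
    using sum_ex_basis_ge_eq_zero[OF fin sub zero, where c = "\<lambda>i. of_int (perturbed d f B i)" and t = "of_int t"]
    by (simp flip: of_int_sum)
  have "(\<Sum>M\<in>\<A>. n M * of_bool (M_generic M (\<lambda>i. real (f i)))) =
    (\<Sum>M\<in>\<A>. \<Sum>B\<in>Pow {1..d}.
       n M * of_bool (\<exists>A\<in>M. sum (perturbed d f B) A \<ge> sum (perturbed d f B) B) -
       n M * of_bool (\<exists>A\<in>M. sum (perturbed d f B) A \<ge> sum (perturbed d f B) B + 1))"
    by (intro sum.cong refl)
      (simp only: of_bool_M_generic[OF sub pos] sum_distrib_left right_diff_distrib)
  also have "\<dots> = 0"
    by (subst sum.swap) (simp add: sum_subtractf ge)
  finally show ?thesis .
qed

subsection \<open>Dependence on the set composition type only\<close>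

text \<open>Swapping the lightest element of \<open>A - B\<close> for a suitable one of
  \<open>B - A\<close> strictly raises the weight and brings \<open>A\<close> closer to
  \<open>B\<close>. The criterion compares single values of \<open>g\<close> only, so it depends
  just on their order.\<close>

lemma matroid_local_max_imp_unique_max:
  fixes g :: "nat \<Rightarrow> 'b::linordered_ab_group_add"
  assumes mat: "matroid d M" and B: "B \<in> M"
    and loc: "\<And>x y. x \<in> B \<Longrightarrow> y \<notin> B \<Longrightarrow> insert y (B - {x}) \<in> M \<Longrightarrow> g y < g x"
    and "A \<in> M" "A \<noteq> B"
  shows "sum g A < sum g B"
  using assms(4,5)
proof (induction "card (B - A)" arbitrary: A rule: less_induct)
  case less
  note A = less.prems
  have exch: "\<exists>y\<in>Q - P. insert y (P - {x}) \<in> M" if "P \<in> M" "Q \<in> M" "x \<in> P - Q" for P Q x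
    using mat that unfolding matroid_def by blast
  have fin: "finite P" if "P \<in> M" for P
    using mat that by (intro finite_subset[of P "{1..d}"]) (auto simp: matroid_def)
  have ne: "A - B \<noteq> {}" "B - A \<noteq> {}"
    using exch[OF A(1) B] exch[OF B A(1)] A(2) by auto
  have finA: "finite (A - B)" using fin[OF A(1)] by simp
  define x where "x = arg_min_on g (A - B)"
  have x: "x \<in> A - B" unfolding x_def using finA ne(1) by (rule arg_min_if_finite(1))
  have x_min: "g x \<le> g y" if "y \<in> A - B" for y
    unfolding x_def using finA ne(1) that by (rule arg_min_least)
  \<comment> \<open>Exchanging \<open>y\<close> out of \<open>B\<close> brings in some
    \<open>z\<close> of \<open>A - B\<close>; local maximality makes \<open>z\<close> lighter than
    \<open>y\<close>, and \<open>x\<close> is no heavier than \<open>z\<close>.\<close>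
  have x_less: "g x < g y" if y: "y \<in> B - A" for y
  proof -
    obtain z where "z \<in> A - B" "insert z (B - {y}) \<in> M" using exch[OF B A(1) y] by blast
    then show ?thesis using loc[of y z] x_min[of z] y by (auto intro: le_less_trans)
  qed
  obtain y where y: "y \<in> B - A" and C: "insert y (A - {x}) \<in> M"
    using exch[OF A(1) B x] by blast
  have "sum g (insert y (A - {x})) = sum g A + (g y - g x)"
    using y fin[OF A(1)] x by (simp add: sum_diff1 algebra_simps)
  then have "sum g A < sum g (insert y (A - {x}))"
    using x_less[OF y] by simp
  moreover have "sum g (insert y (A - {x})) \<le> sum g B"
  proof (cases "insert y (A - {x}) = B")
    case False
    have "B - insert y (A - {x}) \<subset> B - A" using x y by auto
    then have "card (B - insert y (A - {x})) < card (B - A)"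
      using fin[OF B] by (intro psubset_card_mono) auto
    then show ?thesis using less.hyps[OF _ C False] by simp
  qed simp
  ultimately show ?case by simp
qed

text \<open>At the maximizing basis of \<open>f\<close>, each single exchange is a strict comparison
  of two values of \<open>f\<close>. These comparisons carry over to \<open>g\<close>, where local
  maximality suffices.\<close>

lemma M_generic_order_mono:
  fixes f g :: "nat \<Rightarrow> real"
  assumes mat: "matroid d M" and gen: "M_generic M f"
    and ord: "\<And>i j. i \<in> {1..d} \<Longrightarrow> j \<in> {1..d} \<Longrightarrow> f i < f j \<Longrightarrow> g i < g j"
  shows "M_generic M g"
proof -
  obtain B where B: "B \<in> M" and max: "\<And>A. A \<in> M \<Longrightarrow> A \<noteq> B \<Longrightarrow> sum f A < sum f B"
    using gen unfolding M_generic_iff by blast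
  have sub: "P \<subseteq> {1..d}" if "P \<in> M" for P using mat that by (auto simp: matroid_def)
  have "g y < g x" if xy: "x \<in> B" "y \<notin> B" and C: "insert y (B - {x}) \<in> M" for x y
  proof (rule ord)
    have fin: "finite B" using sub[OF B] finite_subset by blast
    have "sum f (insert y (B - {x})) < sum f B" using xy by (intro max C) auto
    then show "f y < f x" using xy fin by (simp add: sum_diff1)
  qed (use xy sub[OF B] sub[OF C] in auto)
  then have "\<forall>A\<in>M. A \<noteq> B \<longrightarrow> sum g A < sum g B"
    by (intro ballI impI matroid_local_max_imp_unique_max[OF mat B])
  then show ?thesis unfolding M_generic_iff using B by blast
qed

text \<open>Blocks are listed by increasing value, so block positions encode the order of the
  values.\<close>

lemma less_iff_set_comp_type:
  fixes f :: "nat \<Rightarrow> nat"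
  assumes ij: "i \<in> {1..d}" "j \<in> {1..d}"
  defines "L \<equiv> set_comp_type d f"
  shows "f i < f j \<longleftrightarrow> (\<exists>p q. p < q \<and> q < length L \<and> i \<in> L ! p \<and> j \<in> L ! q)"
proof -
  define s where "s = sorted_list_of_set (f ` {1..d})"
  have set: "set s = f ` {1..d}" and str: "sorted_wrt (<) s"
    unfolding s_def by auto
  have len: "length L = length s" and nth: "\<And>p. p < length s \<Longrightarrow> L ! p = {i \<in> {1..d}. f i = s ! p}"
    unfolding L_def set_comp_type_def s_def by auto
  have mono: "s ! p < s ! q \<longleftrightarrow> p < q" if "p < length s" "q < length s" for p q
    using str that by (metis linorder_neqE_nat order_less_asym sorted_wrt_nth_less)
  have "\<exists>p<length s. s ! p = f k" if "k \<in> {1..d}" for k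
    using set that by (metis imageI in_set_conv_nth)
  then obtain p q where pq: "p < length s" "s ! p = f i" "q < length s" "s ! q = f j"
    using ij by metis
  show ?thesis
  proof
    assume "f i < f j"
    then have "p < q" using mono pq by metis
    moreover have "i \<in> L ! p" "j \<in> L ! q" using pq nth ij by auto
    ultimately show "\<exists>p q. p < q \<and> q < length L \<and> i \<in> L ! p \<and> j \<in> L ! q" using pq len by auto
  next
    assume "\<exists>p q. p < q \<and> q < length L \<and> i \<in> L ! p \<and> j \<in> L ! q"
    then obtain p q where "p < q" "q < length s" "i \<in> L ! p" "j \<in> L ! q" using len by auto
    then show "f i < f j" using mono[of p q] nth[of p] nth[of q] by simp
  qed
qed

lemma M_generic_set_comp_type:
  assumes mat: "matroid d M" and eq: "set_comp_type d f = set_comp_type d g"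
  shows "M_generic M (\<lambda>i. real (f i)) \<longleftrightarrow> M_generic M (\<lambda>i. real (g i))"
proof -
  have "f i < f j \<longleftrightarrow> g i < g j" if "i \<in> {1..d}" "j \<in> {1..d}" for i j
    using less_iff_set_comp_type[OF that, of f] less_iff_set_comp_type[OF that, of g] eq by simp
  then have "real (f i) < real (f j) \<longleftrightarrow> real (g i) < real (g j)" if "i \<in> {1..d}" "j \<in> {1..d}" for i j
    using that by simp
  then show ?thesis
    using M_generic_order_mono[OF mat, of "\<lambda>i. real (f i)" "\<lambda>i. real (g i)"]
      M_generic_order_mono[OF mat, of "\<lambda>i. real (g i)" "\<lambda>i. real (f i)"] by meson
qed

subsection \<open>The map \<open>\<Psi>\<close>\<close>

lemma inj_on_word_of: "inj_on (word_of d) (letter_maps d)"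
proof (rule inj_onI)
  fix f g assume fg: "f \<in> letter_maps d" "g \<in> letter_maps d" and eq: "word_of d f = word_of d g"
  have "f i = g i" if "i \<in> {1..d}" for i
    using eq that unfolding word_of_def map_eq_conv by (auto simp del: upt_Suc)
  then show "f = g" using fg unfolding letter_maps_def by (metis PiE_ext)
qed

lemma Psi_matroid_word_of:
  assumes "f \<in> letter_maps d"
  shows "Psi_matroid d M (word_of d f) = of_bool (M_generic M (\<lambda>i. real (f i)))"
proof -
  have "{g \<in> letter_maps d. M_generic M (\<lambda>i. real (g i)) \<and> word_of d g = word_of d f} =
    (if M_generic M (\<lambda>i. real (f i)) then {f} else {})"
    using assms inj_onD[OF inj_on_word_of _ _ assms] by auto
  then show ?thesis unfolding Psi_matroid_def by simp
qed

lemma Psi_matroid_not_word_of: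
  "u \<notin> word_of d ` letter_maps d \<Longrightarrow> Psi_matroid d M u = 0"
  unfolding Psi_matroid_def by (auto simp: card_eq_0_iff)

lemma Psi_matroid_in_WQSym_deg: "matroid d M \<Longrightarrow> Psi_matroid d M \<in> WQSym_deg d"
  unfolding WQSym_deg_def
  by (auto simp: Psi_matroid_word_of Psi_matroid_not_word_of dest: M_generic_set_comp_type)

lemma zero_in_WQSym_deg: "0 \<in> WQSym_deg d"
  by (simp add: WQSym_deg_def)

lemma add_in_WQSym_deg: "F \<in> WQSym_deg d \<Longrightarrow> G \<in> WQSym_deg d \<Longrightarrow> F + G \<in> WQSym_deg d"
  unfolding WQSym_deg_def mem_Collect_eq plus_fun_apply by (metis add_0)

lemma scaleR_in_WQSym_deg: "F \<in> WQSym_deg d \<Longrightarrow> c *\<^sub>R F \<in> WQSym_deg d"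
  unfolding WQSym_deg_def mem_Collect_eq scaleR_fun_def by (metis scaleR_zero_right)

lemma sum_in_WQSym_deg: "(\<And>i. i \<in> I \<Longrightarrow> F i \<in> WQSym_deg d) \<Longrightarrow> sum F I \<in> WQSym_deg d"
  by (induction I rule: infinite_finite_induct) (auto simp: zero_in_WQSym_deg add_in_WQSym_deg)

text \<open>Outside the support of \<open>p\<close> both sides vanish because
  \<open>h e 0 = 0\<close>; maps given degree by degree can thus be computed by lookup.\<close>

lemma lookup_sum_single_keys:
  assumes "\<And>d. h d 0 = 0"
  shows "Poly_Mapping.lookup
    (\<Sum>d\<in>Poly_Mapping.keys p. Poly_Mapping.single d (h d (Poly_Mapping.lookup p d))) e =
    h e (Poly_Mapping.lookup p e)"
  using assms by (simp add: lookup_sum lookup_single when_def in_keys_iff)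

lemma lookup_Psi: "Poly_Mapping.lookup (Psi m) d = Psi_deg d (Poly_Mapping.lookup m d)"
  unfolding Psi_def by (rule lookup_sum_single_keys) (simp add: Psi_deg_def fun_eq_iff)

lemma Psi_matroid_elem: "Psi (matroid_elem d M) = Poly_Mapping.single d (Psi_matroid d M)"
  by (rule poly_mapping_eqI)
    (auto simp: lookup_Psi matroid_elem_def lookup_single when_def Psi_deg_def)

lemma Psi_in_WQSym:
  assumes "m \<in> Mat"
  shows "Psi m \<in> WQSym"
proof -
  have "Psi_deg d (Poly_Mapping.lookup m d) \<in> WQSym_deg d" for d
    using assms unfolding Psi_deg_def Mat_def direct_sum_def Mat_deg_def
    by (auto intro!: sum_in_WQSym_deg scaleR_in_WQSym_deg Psi_matroid_in_WQSym_deg)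
  then show ?thesis unfolding WQSym_def direct_sum_def by (simp add: lookup_Psi)
qed

subsection \<open>Factoring through indicator functions\<close>

text \<open>A coefficient function on the finite set of matroids presents an element of
  \<open>PS_deg d\<close>; sums of presentations are pointwise.\<close>

definition indicator_comb :: "nat \<Rightarrow> (nat set set \<Rightarrow> int) \<Rightarrow> (nat \<Rightarrow> real) \<Rightarrow> int" where
  "indicator_comb d n = (\<lambda>x. \<Sum>M | matroid d M. n M * indicator (base_polytope M) x)"

definition Psi_comb :: "nat \<Rightarrow> (nat set set \<Rightarrow> int) \<Rightarrow> (nat list \<Rightarrow> real)" where
  "Psi_comb d n = (\<lambda>u. \<Sum>M | matroid d M. of_int (n M) * Psi_matroid d M u)"

text \<open>An arbitrary presentation of \<open>F\<close> is chosen; independence of the choice is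
  \<open>Psi_hat_deg_indicator_comb\<close>.\<close>

definition Psi_hat_deg :: "nat \<Rightarrow> ((nat \<Rightarrow> real) \<Rightarrow> int) \<Rightarrow> (nat list \<Rightarrow> real)" where
  "Psi_hat_deg d F = Psi_comb d (SOME n. F = indicator_comb d n)"

lemma finite_matroids: "finite {M. matroid d M}"
  by (rule finite_subset[of _ "Pow (Pow {1..d})"]) (auto simp: matroid_def)

lemma indicator_comb_diff: "indicator_comb d (m - n) = indicator_comb d m - indicator_comb d n"
  unfolding indicator_comb_def by (auto simp: fun_eq_iff left_diff_distrib sum_subtractf)

lemma indicator_comb_add: "indicator_comb d (m + n) = indicator_comb d m + indicator_comb d n"
  unfolding indicator_comb_def by (auto simp: fun_eq_iff distrib_right sum.distrib)

lemma Psi_comb_diff: "Psi_comb d (m - n) = Psi_comb d m - Psi_comb d n"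
  unfolding Psi_comb_def by (auto simp: fun_eq_iff left_diff_distrib sum_subtractf)

lemma Psi_comb_add: "Psi_comb d (m + n) = Psi_comb d m + Psi_comb d n"
  unfolding Psi_comb_def by (auto simp: fun_eq_iff distrib_right sum.distrib)

lemma indicator_comb_single:
  assumes "matroid d M"
  shows "indicator_comb d (\<lambda>N. of_bool (N = M)) = indicator (base_polytope M)"
proof -
  have "{N. matroid d N} \<inter> {N. N = M} = {M}" using assms by auto
  then show ?thesis unfolding indicator_comb_def using finite_matroids by simp
qed

lemma Psi_comb_single:
  assumes "matroid d M"
  shows "Psi_comb d (\<lambda>N. of_bool (N = M)) = Psi_matroid d M"
proof -
  have "{N. matroid d N} \<inter> {N. N = M} = {M}" using assms by auto
  then show ?thesis unfolding Psi_comb_def using finite_matroids by simp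
qed

lemma sum_fun_apply: "sum F I x = (\<Sum>i\<in>I. F i x)"
  by (induction I rule: infinite_finite_induct) simp_all

lemma Psi_comb_in_WQSym_deg: "Psi_comb d n \<in> WQSym_deg d"
proof -
  have "Psi_comb d n = (\<Sum>M | matroid d M. real_of_int (n M) *\<^sub>R Psi_matroid d M)"
    unfolding Psi_comb_def by (simp add: fun_eq_iff sum_fun_apply scaleR_fun_def)
  then show ?thesis
    by (auto intro!: sum_in_WQSym_deg scaleR_in_WQSym_deg Psi_matroid_in_WQSym_deg)
qed

text \<open>The combinations contain 0 and the generators and are closed under differences.\<close>

lemma PS_deg_imp_indicator_comb:
  assumes "F \<in> PS_deg d"
  shows "\<exists>n. F = indicator_comb d n"
  using assms unfolding PS_deg_def
proof induction
  case (base F)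
  then show ?case
  proof
    assume "F = 0"
    then have "F = indicator_comb d 0" by (simp add: indicator_comb_def fun_eq_iff)
    then show ?thesis by blast
  next
    assume "F \<in> {indicator (base_polytope M) |M. matroid d M}"
    then obtain M where "matroid d M" "F = indicator (base_polytope M)" by blast
    then show ?thesis using indicator_comb_single[of d M] by metis
  qed
next
  case (diff F G)
  then show ?case by (metis indicator_comb_diff)
qed

text \<open>This is the well-definedness of the factorization, checked word by word: the coefficient
  of \<open>w_f\<close> counts generic matroids for the fixed \<open>f\<close>.\<close>

lemma Psi_comb_eq_zero:
  assumes "indicator_comb d n = 0"
  shows "Psi_comb d n = 0"
proof
  fix u
  show "Psi_comb d n u = 0 u"
  proof (cases "u \<in> word_of d ` letter_maps d")
    case True
    then obtain f where f: "f \<in> letter_maps d" "u = word_of d f" by blast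
    have "Psi_comb d n u =
      of_int (\<Sum>M | matroid d M. n M * of_bool (M_generic M (\<lambda>i. real (f i))))"
      unfolding Psi_comb_def f(2) Psi_matroid_word_of[OF f(1)] by simp
    also have "(\<Sum>M | matroid d M. n M * of_bool (M_generic M (\<lambda>i. real (f i)))) = 0"
    proof (rule sum_generic_eq_zero[OF finite_matroids])
      show "(\<Sum>M | matroid d M. n M * indicator (base_polytope M) x) = 0" for x
        using fun_cong[OF assms, of x] by (simp add: indicator_comb_def)
    qed (use f(1) in \<open>auto simp: matroid_def letter_maps_def PiE_def Pi_def\<close>)
    finally show ?thesis by simp
  next
    case False
    then show ?thesis by (simp add: Psi_comb_def Psi_matroid_not_word_of)
  qed
qed

text \<open>The chosen and the given presentation differ by a relation, which
  \<open>Psi_comb\<close> kills.\<close>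

lemma Psi_hat_deg_indicator_comb: "Psi_hat_deg d (indicator_comb d n) = Psi_comb d n"
proof -
  define m where "m = (SOME m. indicator_comb d n = indicator_comb d m)"
  have "indicator_comb d n = indicator_comb d m" unfolding m_def
    by (rule someI[where P = "\<lambda>m. indicator_comb d n = indicator_comb d m", OF refl])
  then have "Psi_comb d (m - n) = 0" by (intro Psi_comb_eq_zero) (simp add: indicator_comb_diff)
  then show ?thesis unfolding Psi_hat_deg_def m_def[symmetric] by (simp add: Psi_comb_diff)
qed

lemma Psi_hat_deg_add:
  "F \<in> PS_deg d \<Longrightarrow> G \<in> PS_deg d \<Longrightarrow> Psi_hat_deg d (F + G) = Psi_hat_deg d F + Psi_hat_deg d G"
  by (metis PS_deg_imp_indicator_comb Psi_hat_deg_indicator_comb indicator_comb_add Psi_comb_add)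

lemma Psi_hat_deg_zero: "Psi_hat_deg d 0 = 0"
  using Psi_hat_deg_add[of 0 d 0] by (simp add: PS_deg_def)

definition Psi_hat :: "(nat \<Rightarrow>\<^sub>0 (nat \<Rightarrow> real) \<Rightarrow> int) \<Rightarrow> (nat \<Rightarrow>\<^sub>0 nat list \<Rightarrow> real)" where
  "Psi_hat p =
     (\<Sum>d\<in>Poly_Mapping.keys p. Poly_Mapping.single d (Psi_hat_deg d (Poly_Mapping.lookup p d)))"

lemma lookup_Psi_hat:
  "Poly_Mapping.lookup (Psi_hat p) d = Psi_hat_deg d (Poly_Mapping.lookup p d)"
  unfolding Psi_hat_def by (rule lookup_sum_single_keys) (rule Psi_hat_deg_zero)

theorem corollary4p7:
  shows "Psi \<in> Mat \<rightarrow> WQSym \<and> strongly_valuative WQSym Psi"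
proof -
  \<comment> \<open>No membership of \<open>p\<close> in \<open>PS\<close> is required: whatever the
    choice returns, each degree is a \<open>Psi_comb\<close>.\<close>
  have "Psi_hat p \<in> WQSym" for p
    unfolding WQSym_def direct_sum_def
    by (simp add: lookup_Psi_hat Psi_hat_deg_def Psi_comb_in_WQSym_deg)
  moreover have "Psi_hat (p + q) = Psi_hat p + Psi_hat q" if "p \<in> PS" "q \<in> PS" for p q
    using that by (intro poly_mapping_eqI)
      (auto simp: lookup_Psi_hat lookup_add PS_def direct_sum_def Psi_hat_deg_add)
  moreover have "Psi (matroid_elem d M) = Psi_hat (indicator_elem d M)" if "matroid d M" for d M
    using Psi_hat_deg_indicator_comb[of d "\<lambda>N. of_bool (N = M)"] that
    by (intro poly_mapping_eqI)
      (auto simp: Psi_matroid_elem lookup_Psi_hat indicator_elem_def lookup_single when_def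
        Psi_hat_deg_zero indicator_comb_single Psi_comb_single)
  ultimately have "strongly_valuative WQSym Psi" unfolding strongly_valuative_def by blast
  then show ?thesis using Psi_in_WQSym by blast
qed

end
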